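(* Let $X\subseteq\mathbb{Z}^{p_1}\times\mathbb{R}^{n_1-p_1}$ and consider a piecewise constant function $g(\mathbf{x}):=\sum_{k=1}^K g_k\,\mathbf{1}(\mathbf{x}\in\mathcal{P}_k)$ on $X$, where $\{g_k:k\in[K]\}$ are fixed constants and $\{\mathcal{P}_k:k\in[K]\}$ form a polyhedral partition of $X$ with $\operatorname{cl}(\mathcal{P}_k)=\{\mathbf{x}\in\mathbb{R}^{n_1}:\mathbf{A}_k\mathbf{x}\le\mathbf{b}_k\}$, $X=\bigcup_{k=1}^K\mathcal{P}_k$, and $\mathcal{P}_j\cap\mathcal{P}_k=\varnothing$ whenever $j\neq k$. Then the convex envelope of $g$ is given by $$\overline{\operatorname{co}}(g)\ =\ \big\{(\mathbf{x},\theta)\in X\times\mathbb{R}:\ \theta\ge\alpha+\boldsymbol{\beta}^\top\mathbf{x},\ \ \forall(\alpha,\boldsymbol{\beta})\in\operatorname{ext}(E)\big\},$$ where the polyhedron $E$ is defined by $$E:=\big\{(\alpha,\boldsymbol{\beta})\ \big|\ \exists\,\boldsymbol{\eta}_k\ge\mathbf{0}:\ \alpha+\mathbf{b}_k^\top\boldsymbol{\eta}_k\le g_k,\ \ \mathbf{A}_k^\top\boldsymbol{\eta}_k=\boldsymbol{\beta},\ \ \forall k\in[K]\big\}.$$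
   Context: $[K]:=\{1,\dots,K\}$; $\operatorname{cl}$ denotes closure; $\mathbf{1}(\cdot)$ is the $0/1$ indicator; $(\alpha,\boldsymbol{\beta})\in\mathbb{R}\times\mathbb{R}^{n_1}$; $\operatorname{ext}(E)$ is the set of extreme points of $E$. The convex envelope of $g:X\to\mathbb{R}$ at $\mathbf{x}$ is the supremum of $a(\mathbf{x})$ over all affine functions $a:\mathbb{R}^{n_1}\to\mathbb{R}$ with $a\le g$ on $X$. In the displayed formula, $\overline{\operatorname{co}}(g)$ is identified with its epigraph, i.e. the set of pairs $(\mathbf{x},\theta)\in X\times\mathbb{R}$ with $\theta$ at least the value of the convex envelope at $\mathbf{x}$.
   Formalization: The formal statement adds that a nonempty X has affine hull all of R^{n_1}; otherwise E contains a line, ext(E) is empty and the formula fails (e.g. X={0} in R, g=0). The parts of the partition are taken to be nonempty. *)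

theory Defs
  imports "HOL-Analysis.Analysis"
begin

text \<open>The integer coordinates are an arbitrary subset \<open>I\<close> of the index type, so \<open>p\<^sub>1 = card I\<close>;
  both \<open>I = {}\<close> and \<open>I = UNIV\<close> are allowed.\<close>

definition mixed_integer_space :: "'n::finite set \<Rightarrow> (real ^ 'n) set" where
  "mixed_integer_space I = {x. \<forall>i\<in>I. x $ i \<in> \<int>}"

text \<open>The number of rows of the matrices \<open>A\<^sub>k\<close> may depend on \<open>k\<close>. A matrix with \<open>m\<close> rows is therefore
  given by its row vectors \<open>A 0, \<dots>, A (m - 1)\<close>, and vectors in \<open>\<real>\<^sup>m\<close> are functions on \<open>nat\<close> of which
  only the values below \<open>m\<close> matter. The three definitions below are \<open>{x. A x \<le> b}\<close>,
  the product of the transpose of \<open>A\<close> with \<open>\<eta>\<close>, and the inner product of \<open>b\<close> and \<open>\<eta>\<close>.\<close>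

definition ineq_polyhedron ::
  "nat \<Rightarrow> (nat \<Rightarrow> real ^ 'n::finite) \<Rightarrow> (nat \<Rightarrow> real) \<Rightarrow> (real ^ 'n) set" where
  "ineq_polyhedron m A b = {x. \<forall>i<m. A i \<bullet> x \<le> b i}"

definition transpose_mult ::
  "nat \<Rightarrow> (nat \<Rightarrow> real ^ 'n::finite) \<Rightarrow> (nat \<Rightarrow> real) \<Rightarrow> real ^ 'n" where
  "transpose_mult m A \<eta> = (\<Sum>i<m. \<eta> i *\<^sub>R A i)"

definition dot :: "nat \<Rightarrow> (nat \<Rightarrow> real) \<Rightarrow> (nat \<Rightarrow> real) \<Rightarrow> real" where
  "dot m b \<eta> = (\<Sum>i<m. b i * \<eta> i)"

definition piecewise_constant ::
  "nat \<Rightarrow> (nat \<Rightarrow> real) \<Rightarrow> (nat \<Rightarrow> (real ^ 'n::finite) set) \<Rightarrow> real ^ 'n \<Rightarrow> real" where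
  "piecewise_constant K c P x = (\<Sum>k=1..K. c k * indicator (P k) x)"

definition affine_function :: "('a::real_vector \<Rightarrow> real) \<Rightarrow> bool" where
  "affine_function a \<longleftrightarrow> (\<exists>f c. linear f \<and> a = (\<lambda>x. c + f x))"

text \<open>The supremum is taken in the extended reals, so that it is meaningful also when
  there is no affine minorant or the values at \<open>x\<close> are unbounded.\<close>

definition convex_envelope ::
  "'a::real_vector set \<Rightarrow> ('a \<Rightarrow> real) \<Rightarrow> 'a \<Rightarrow> ereal" where
  "convex_envelope X g x =
     (SUP a \<in> {a. affine_function a \<and> (\<forall>y\<in>X. a y \<le> g y)}. ereal (a x))"

definition convex_envelope_epigraph ::
  "'a::real_vector set \<Rightarrow> ('a \<Rightarrow> real) \<Rightarrow> ('a \<times> real) set" where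
  "convex_envelope_epigraph X g = {(x, \<theta>). x \<in> X \<and> convex_envelope X g x \<le> ereal \<theta>}"

definition ext :: "'a::real_vector set \<Rightarrow> 'a set" where
  "ext S = {x. x extreme_point_of S}"

definition polyhedron_E ::
  "nat \<Rightarrow> (nat \<Rightarrow> nat) \<Rightarrow> (nat \<Rightarrow> nat \<Rightarrow> real ^ 'n::finite) \<Rightarrow> (nat \<Rightarrow> nat \<Rightarrow> real) \<Rightarrow> (nat \<Rightarrow> real)
    \<Rightarrow> (real \<times> (real ^ 'n)) set" where
  "polyhedron_E K m A b c =
     {(\<alpha>, \<beta>). \<exists>\<eta> :: nat \<Rightarrow> nat \<Rightarrow> real. \<forall>k\<in>{1..K}.
        (\<forall>i<m k. 0 \<le> \<eta> k i) \<and>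
        \<alpha> + dot (m k) (b k) (\<eta> k) \<le> c k \<and>
        transpose_mult (m k) (A k) (\<eta> k) = \<beta>}"

end

theory Submission
  imports Defs
begin

text \<open>By Farkas' lemma, \<open>E\<close> is the set of affine minorants of \<open>g\<close>, which is closed, convex and, as
  \<open>X\<close> affinely spans the space, line-free. For \<open>x \<in> X\<close> the evaluation \<open>(\<alpha>, \<beta>) \<mapsto> \<alpha> + \<beta> \<bullet> x\<close> is
  a linear functional on \<open>E\<close> bounded above by \<open>g x\<close>, and on a line-free closed convex set every value
  of such a functional is dominated by its value at some extreme point.\<close>

section \<open>Extreme points of line-free closed convex sets\<close>

text \<open>The parameters that keep the ray in \<open>S\<close> form a closed set, bounded by
  \<open>s\<close> since convexity allows no return to \<open>S\<close>; their supremum is the exit.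
  From a relative interior point the ray could continue a little, as it runs inside
  \<open>affine hull S\<close>.\<close>

lemma ray_exit_point:
  fixes S :: "'a::euclidean_space set"
  assumes "closed S" "convex S" and p: "p \<in> S"
    and d: "p + d \<in> affine hull S" and s: "0 \<le> s" "p + s *\<^sub>R d \<notin> S"
  obtains t where "0 \<le> t" "p + t *\<^sub>R d \<in> S" "p + t *\<^sub>R d \<notin> rel_interior S"
proof -
  define T where "T = {t. 0 \<le> t \<and> p + t *\<^sub>R d \<in> S}"
  have 0: "0 \<in> T"
    using p by (simp add: T_def)
  have le: "t \<le> s" if "t \<in> T" for t
  proof (rule ccontr)
    assume "\<not> t \<le> s"
    then have t: "s < t" "0 < t" using s by auto
    have "(1 - s / t) *\<^sub>R p + (s / t) *\<^sub>R (p + t *\<^sub>R d) \<in> S"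
      using that p t s by (intro convexD[OF \<open>convex S\<close>]) (auto simp: T_def)
    also have "(1 - s / t) *\<^sub>R p + (s / t) *\<^sub>R (p + t *\<^sub>R d) = p + s *\<^sub>R d"
      using t by (simp add: algebra_simps)
    finally show False using s by blast
  qed
  have "closed T"
  proof -
    have "T = {0..} \<inter> (\<lambda>t. p + t *\<^sub>R d) -` S"
      by (auto simp: T_def)
    moreover have "closed ((\<lambda>t. p + t *\<^sub>R d) -` S)"
      by (intro closed_vimage \<open>closed S\<close> continuous_intros)
    ultimately show ?thesis
      by (simp add: closed_Int)
  qed
  have bdd: "bdd_above T"
    using le by (auto simp: bdd_above_def)
  have sup: "Sup T \<in> T"
    using 0 \<open>closed T\<close> bdd by (intro closed_contains_Sup) auto
  have "p + Sup T *\<^sub>R d \<notin> rel_interior S"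
  proof
    let ?q = "p + Sup T *\<^sub>R d"
    assume "?q \<in> rel_interior S"
    then obtain e where e: "e > 0" "cball ?q e \<inter> affine hull S \<subseteq> S"
      by (auto simp: mem_rel_interior_cball)
    \<comment> \<open>The extra step \<open>r *\<^sub>R d\<close> has length at most
      \<open>e\<close>; the \<open>+ 1\<close> keeps the denominator positive without a case split
      on \<open>d\<close>.\<close>
    define r where "r = e / (norm d + 1)"
    have r: "r > 0" "r * norm d \<le> e"
    proof -
      show "r > 0" using e by (simp add: r_def add_nonneg_pos)
      have "r * norm d \<le> r * (norm d + 1)" using \<open>r > 0\<close> by simp
      also have "\<dots> = e" using norm_ge_zero[of d] by (simp add: r_def field_simps add_nonneg_eq_0_iff)
      finally show "r * norm d \<le> e" .
    qed
    have "(1 - (Sup T + r)) *\<^sub>R p + (Sup T + r) *\<^sub>R (p + d) \<in> affine hull S"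
      using d hull_inc[OF p] by (intro mem_affine[OF affine_affine_hull]) auto
    then have "p + (Sup T + r) *\<^sub>R d \<in> affine hull S"
      by (simp add: algebra_simps)
    moreover have "p + (Sup T + r) *\<^sub>R d \<in> cball ?q e"
      using r by (simp add: dist_norm algebra_simps)
    ultimately have "Sup T + r \<in> T"
      using e sup r by (auto simp: T_def)
    then have "Sup T + r \<le> Sup T"
      using bdd by (rule cSup_upper)
    with r show False by simp
  qed
  with that sup show ?thesis
    by (auto simp: T_def)
qed

text \<open>Induction on the dimension: move \<open>p\<close> to the relative boundary in a direction in which \<open>a\<close> does
  not decrease, then pass to a proper face through the exit point. If the ray in such a direction
  stays in \<open>S\<close>, then \<open>a\<close> is constant along it and the opposite ray has to leave \<open>S\<close>.\<close>

lemma line_free_extreme_point_ge: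
  fixes S :: "'a::euclidean_space set"
  assumes "closed S" "convex S"
    and "\<And>p d. p \<in> S \<Longrightarrow> d \<noteq> 0 \<Longrightarrow> \<exists>t. p + t *\<^sub>R d \<notin> S"
    and "\<And>y. y \<in> S \<Longrightarrow> a \<bullet> y \<le> B"
    and "p \<in> S"
  shows "\<exists>e. e extreme_point_of S \<and> a \<bullet> p \<le> a \<bullet> e"
  using assms
proof (induction "nat (aff_dim S)" arbitrary: S p rule: less_induct)
  case less
  note cl = less.prems(1) and cv = less.prems(2) and nl = less.prems(3) and bd = less.prems(4)
  have boundary: "\<exists>e. e extreme_point_of S \<and> a \<bullet> q \<le> a \<bullet> e"
    if q: "q \<in> S" "q \<notin> rel_interior S" for q
  proof -
    obtain u where u: "\<And>y. y \<in> S \<Longrightarrow> u \<bullet> q \<le> u \<bullet> y"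
      "\<And>y. y \<in> rel_interior S \<Longrightarrow> u \<bullet> q < u \<bullet> y"
      using supporting_hyperplane_rel_boundary[OF cv q] by metis
    define F where "F = S \<inter> {y. u \<bullet> y = u \<bullet> q}"
    have face: "F face_of S"
      unfolding F_def using u cv by (intro face_of_Int_supporting_hyperplane_ge) auto
    have "rel_interior S \<noteq> {}"
      using q cv rel_interior_eq_empty by blast
    then have "F \<noteq> S"
      using u(2) rel_interior_subset[of S] unfolding F_def by force
    then have "aff_dim F < aff_dim S"
      using face_of_aff_dim_lt[OF cv face] by blast
    moreover have "q \<in> F" using q by (simp add: F_def)
    \<comment> \<open>Since \<open>nat\<close> merges the dimensions -1 and 0, the strict drop of
      the measure rests on \<open>F\<close> being nonempty.\<close>
    then have "0 \<le> aff_dim F" by (metis aff_dim_negative_iff empty_iff not_less)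
    ultimately have "nat (aff_dim F) < nat (aff_dim S)" by linarith
    then have "\<exists>e. e extreme_point_of F \<and> a \<bullet> q \<le> a \<bullet> e"
    proof (rule less.hyps)
      show "closed F" unfolding F_def by (intro closed_Int cl closed_hyperplane)
      show "convex F" using face face_of_imp_convex by blast
      show "\<exists>t. y + t *\<^sub>R d \<notin> F" if "y \<in> F" "d \<noteq> 0" for y d
        using nl[of y d] that by (auto simp: F_def)
      show "a \<bullet> y \<le> B" if "y \<in> F" for y
        using bd that by (simp add: F_def)
      show "q \<in> F" by fact
    qed
    then show ?thesis
      using extreme_point_of_face[OF face] by blast
  qed
  have p: "p \<in> S" by fact
  show ?case
  proof (cases "S = {p}")
    case True
    then show ?thesis by auto
  next
    case False
    then obtain y where y: "y \<in> S" "y \<noteq> p" using p by blast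
    define d0 where "d0 = y - p"
    \<comment> \<open>Both signs are prepared because the direction may be reversed twice: to make
      \<open>a\<close> nondecreasing, and when the ray never leaves \<open>S\<close>. The point
      \<open>p - d0\<close> is the reflection of \<open>y\<close> in \<open>p\<close>.\<close>
    have aff: "p + d0 \<in> affine hull S" "p + - d0 \<in> affine hull S"
    proof -
      show "p + d0 \<in> affine hull S"
        using y by (simp add: d0_def hull_inc)
      have "2 *\<^sub>R p + (-1) *\<^sub>R y \<in> affine hull S"
        using p y by (intro mem_affine[OF affine_affine_hull] hull_inc) auto
      then show "p + - d0 \<in> affine hull S"
        by (simp add: d0_def algebra_simps scaleR_2)
    qed
    obtain s d where d: "p + d \<in> affine hull S" "0 \<le> a \<bullet> d" and s: "0 \<le> s" "p + s *\<^sub>R d \<notin> S"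
    proof -
      obtain d1 where d1: "d1 \<noteq> 0" "p + d1 \<in> affine hull S" "p + - d1 \<in> affine hull S" "0 \<le> a \<bullet> d1"
      proof (cases "0 \<le> a \<bullet> d0")
        case True
        then show ?thesis using that[of d0] aff y by (simp add: d0_def)
      next
        case False
        then show ?thesis using that[of "- d0"] aff y by (simp add: d0_def inner_diff_right)
      qed
      show ?thesis
      proof (cases "\<exists>s\<ge>0. p + s *\<^sub>R d1 \<notin> S")
        case True
        then show ?thesis using that d1 by blast
      next
        case False
        then have ray: "p + s *\<^sub>R d1 \<in> S" if "0 \<le> s" for s
          using that by blast
        have "a \<bullet> d1 = 0"
        proof (rule ccontr)
          assume "a \<bullet> d1 \<noteq> 0"
          with d1 have pos: "a \<bullet> d1 > 0" by simp
          \<comment> \<open>With this \<open>s\<close>, \<open>a\<close> takes the value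
            \<open>a \<bullet> p + \<bar>B - a \<bullet> p\<bar> + 1\<close> on the ray, which
            exceeds \<open>B\<close>.\<close>
          define s where "s = (\<bar>B - a \<bullet> p\<bar> + 1) / (a \<bullet> d1)"
          have "a \<bullet> (p + s *\<^sub>R d1) \<le> B"
            using pos by (intro bd ray) (simp add: s_def)
          then show False
            using pos by (simp add: s_def inner_add_right)
        qed
        moreover obtain t where t: "p + t *\<^sub>R d1 \<notin> S"
          using nl p d1 by blast
        moreover have "t < 0"
          using ray[of t] t by force
        ultimately show ?thesis
          using that[of "- d1" "- t"] d1 by simp
      qed
    qed
    obtain t where t: "0 \<le> t" "p + t *\<^sub>R d \<in> S" "p + t *\<^sub>R d \<notin> rel_interior S"
      using ray_exit_point[OF cl cv p d(1) s] .
    have "a \<bullet> p \<le> a \<bullet> (p + t *\<^sub>R d)"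
      using t d by (simp add: inner_add_right)
    with boundary[OF t(2,3)] show ?thesis
      by force
  qed
qed

section \<open>Affine Farkas lemma\<close>

text \<open>The nonnegative combinations already form a convex cone containing the generators.
  Coefficients are indexed by position and not by vector, so repeated generators do no harm.\<close>

lemma convex_cone_hull_image_lessThan:
  fixes v :: "nat \<Rightarrow> 'a::real_vector"
  assumes "z \<in> convex_cone hull (v ` {..<m})"
  obtains \<eta> where "\<And>i. 0 \<le> \<eta> i" "z = (\<Sum>i<m. \<eta> i *\<^sub>R v i)"
proof -
  let ?C = "{z. \<exists>\<eta>. (\<forall>i. 0 \<le> \<eta> i) \<and> z = (\<Sum>i<m. \<eta> i *\<^sub>R v i)}"
  have "convex_cone ?C"
    unfolding convex_cone_iff
  proof (intro conjI ballI allI impI)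
    show "0 \<in> ?C" by (auto intro!: exI[of _ "\<lambda>_. 0"])
    fix x assume "x \<in> ?C"
    then obtain \<eta> where \<eta>: "\<And>i. 0 \<le> \<eta> i" "x = (\<Sum>i<m. \<eta> i *\<^sub>R v i)" by blast
    {
      fix y assume "y \<in> ?C"
      then obtain \<mu> where "\<And>i. 0 \<le> \<mu> i" "y = (\<Sum>i<m. \<mu> i *\<^sub>R v i)" by blast
      with \<eta> show "x + y \<in> ?C"
        by (auto intro!: exI[of _ "\<lambda>i. \<eta> i + \<mu> i"] simp: scaleR_add_left sum.distrib)
    }
    {
      fix r :: real assume "0 \<le> r"
      with \<eta> show "r *\<^sub>R x \<in> ?C"
        by (auto intro!: exI[of _ "\<lambda>i. r * \<eta> i"] simp: scaleR_sum_right)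
    }
  qed
  moreover have "v ` {..<m} \<subseteq> ?C"
  proof clarify
    fix j assume j: "j < m"
    have "v j = (\<Sum>i<m. (if i = j then 1 else 0) *\<^sub>R v i)"
      using j by (subst sum.remove[of _ j]) (auto intro!: sum.neutral)
    then show "\<exists>\<eta>. (\<forall>i. 0 \<le> \<eta> i) \<and> v j = (\<Sum>i<m. \<eta> i *\<^sub>R v i)"
      by (intro exI[of _ "\<lambda>i. if i = j then 1 else 0"]) auto
  qed
  ultimately have "z \<in> ?C"
    using assms hull_minimal[of "v ` {..<m}" ?C convex_cone] by blast
  with that show ?thesis by blast
qed

text \<open>The inequality \<open>\<beta> \<bullet> x \<le> \<gamma>\<close> follows from the system iff \<open>(\<beta>, \<gamma>)\<close> lies in the finitely generated,
  hence closed, cone spanned by the \<open>(A i, b i)\<close> and the trivial inequality \<open>(0, 1)\<close>. A separating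
  functional \<open>(u, t)\<close> yields a violating point \<open>- u / t\<close> if \<open>t > 0\<close>, and a violating ray
  with direction \<open>- u\<close> if \<open>t = 0\<close>.\<close>

lemma affine_farkas:
  assumes ne: "ineq_polyhedron m A b \<noteq> {}"
    and le: "\<And>x. x \<in> ineq_polyhedron m A b \<Longrightarrow> \<beta> \<bullet> x \<le> \<gamma>"
  obtains \<eta> where "\<And>i. 0 \<le> \<eta> i" "dot m b \<eta> \<le> \<gamma>" "transpose_mult m A \<eta> = \<beta>"
proof -
  \<comment> \<open>Index \<open>m\<close> holds the trivial inequality, hence \<open>Suc m\<close>
    generators; its multiplier \<open>\<eta> m\<close> becomes the slack between
    \<open>dot m b \<eta>\<close> and \<open>\<gamma>\<close>.\<close>
  define v where "v i = (if i < m then (A i, b i) else (0, 1))" for i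
  define C where "C = convex_cone hull (v ` {..<Suc m})"
  have "(\<beta>, \<gamma>) \<in> C"
  proof (rule ccontr)
    assume "(\<beta>, \<gamma>) \<notin> C"
    moreover have "convex C" "closed C"
      by (auto simp: C_def convex_convex_cone_hull intro!: closed_convex_cone_hull)
    ultimately obtain w l where w: "w \<bullet> (\<beta>, \<gamma>) < l" "\<And>z. z \<in> C \<Longrightarrow> l < w \<bullet> z"
      using separating_hyperplane_closed_point by metis
    obtain u t where ut: "w = (u, t)" by fastforce
    \<comment> \<open>As \<open>0 \<in> C\<close>, the level \<open>l\<close> is negative.\<close>
    have neg: "w \<bullet> (\<beta>, \<gamma>) < 0"
      using w(1) w(2)[of 0] by (simp add: C_def convex_cone_hull_contains_0)
    have nonneg: "0 \<le> w \<bullet> z" if "z \<in> C" for z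
    proof (rule ccontr)
      assume "\<not> 0 \<le> w \<bullet> z"
      then have z: "w \<bullet> z < 0" by simp
      \<comment> \<open>A cone is closed under scaling: this multiple of \<open>z\<close> has the
        value \<open>- \<bar>l\<bar>\<close>, which is not above \<open>l\<close>.\<close>
      have "(\<bar>l\<bar> / - (w \<bullet> z)) *\<^sub>R z \<in> C"
        using that z unfolding C_def by (intro convex_cone_hull_mul) (auto simp: field_simps)
      then have "l < w \<bullet> ((\<bar>l\<bar> / - (w \<bullet> z)) *\<^sub>R z)" by (rule w)
      then show False using z by simp
    qed
    have gen: "0 \<le> w \<bullet> v i" if "i < Suc m" for i
      using that by (intro nonneg) (auto simp: C_def intro!: hull_inc)
    have t: "0 \<le> t"
      using gen[of m] by (simp add: v_def ut)
    have rows: "0 \<le> u \<bullet> A i + t * b i" if "i < m" for i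
      using gen[of i] that by (simp add: v_def ut)
    show False
    proof (cases "t = 0")
      case True
      obtain x where x: "x \<in> ineq_polyhedron m A b" using ne by blast
      have u: "u \<bullet> \<beta> < 0" using neg True by (simp add: ut)
      \<comment> \<open>Moving by \<open>- s *\<^sub>R u\<close> raises
        \<open>\<beta> \<bullet> x\<close> by
        \<open>\<bar>\<gamma> - \<beta> \<bullet> x\<bar> + 1\<close>, hence past
        \<open>\<gamma>\<close>.\<close>
      define s where "s = (\<bar>\<gamma> - \<beta> \<bullet> x\<bar> + 1) / - (u \<bullet> \<beta>)"
      have s: "0 \<le> s" using u unfolding s_def by (intro divide_nonneg_pos) auto
      have "x - s *\<^sub>R u \<in> ineq_polyhedron m A b"
      proof (unfold ineq_polyhedron_def, clarify)
        fix i assume i: "i < m"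
        have "A i \<bullet> x \<le> b i" using x i by (simp add: ineq_polyhedron_def)
        moreover have "0 \<le> s * (u \<bullet> A i)" using s rows[OF i] True by simp
        ultimately show "A i \<bullet> (x - s *\<^sub>R u) \<le> b i"
          by (simp add: inner_diff_right inner_commute)
      qed
      then have "\<beta> \<bullet> (x - s *\<^sub>R u) \<le> \<gamma>" by (rule le)
      moreover have "s * (\<beta> \<bullet> u) = - (\<bar>\<gamma> - \<beta> \<bullet> x\<bar> + 1)"
        using u by (simp add: s_def inner_commute)
      ultimately show False
        by (simp add: inner_diff_right)
    next
      case False
      with t have t: "t > 0" by simp
      have "- (u /\<^sub>R t) \<in> ineq_polyhedron m A b"
      proof (unfold ineq_polyhedron_def, clarify)
        fix i assume "i < m"
        then have "- (t * b i) \<le> u \<bullet> A i" using rows[of i] by linarith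
        then show "A i \<bullet> - (u /\<^sub>R t) \<le> b i"
          using t by (simp add: inner_commute field_simps)
      qed
      then have "\<beta> \<bullet> - (u /\<^sub>R t) \<le> \<gamma>" by (rule le)
      then show False
        using neg t by (simp add: ut inner_commute field_simps)
    qed
  qed
  then obtain \<eta> where \<eta>: "\<And>i. 0 \<le> \<eta> i" "(\<beta>, \<gamma>) = (\<Sum>i<Suc m. \<eta> i *\<^sub>R v i)"
    unfolding C_def by (rule convex_cone_hull_image_lessThan) blast
  have "(\<Sum>i<m. \<eta> i *\<^sub>R v i) = (\<Sum>i<m. (\<eta> i *\<^sub>R A i, \<eta> i * b i))"
    by (intro sum.cong) (auto simp: v_def)
  then have "\<beta> = (\<Sum>i<m. \<eta> i *\<^sub>R A i)" "\<gamma> = (\<Sum>i<m. \<eta> i * b i) + \<eta> m"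
    using \<eta>(2) by (simp_all add: v_def sum_prod)
  then show ?thesis
    using \<eta>(1)[of m] that[of \<eta>] \<eta>(1)
    by (simp add: dot_def transpose_mult_def mult.commute)
qed

text \<open>Weak duality, the easy converse of Farkas: add up the rows with the weights
  \<open>\<eta> i\<close>.\<close>

lemma inner_transpose_mult_le_dot:
  assumes "x \<in> ineq_polyhedron m A b" "\<And>i. i < m \<Longrightarrow> 0 \<le> \<eta> i"
  shows "transpose_mult m A \<eta> \<bullet> x \<le> dot m b \<eta>"
  using assms unfolding transpose_mult_def dot_def ineq_polyhedron_def
  by (auto simp: inner_sum_left mult.commute[of "b _"] intro!: sum_mono mult_left_mono)

section \<open>The polyhedron E as a set of affine minorants\<close>

text \<open>The multipliers \<open>\<eta> k\<close> certify the bound \<open>c k\<close> on the k-th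
  piece: weak duality shows that they suffice, Farkas that they exist. Nonempty pieces give the
  consistent systems that Farkas requires.\<close>

lemma polyhedron_E_eq:
  assumes ne: "\<And>k. k \<in> {1..K} \<Longrightarrow> P k \<noteq> {}"
    and cl: "\<And>k. k \<in> {1..K} \<Longrightarrow> closure (P k) = ineq_polyhedron (m k) (A k) (b k)"
  shows "polyhedron_E K m A b c = {(\<alpha>, \<beta>). \<forall>k\<in>{1..K}. \<forall>x\<in>P k. \<alpha> + \<beta> \<bullet> x \<le> c k}"
    (is "?E = ?M")
proof (intro equalityI subrelI)
  fix \<alpha> \<beta> assume "(\<alpha>, \<beta>) \<in> ?E"
  then obtain \<eta> where \<eta>: "\<And>k i. k \<in> {1..K} \<Longrightarrow> i < m k \<Longrightarrow> 0 \<le> \<eta> k i"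
    "\<And>k. k \<in> {1..K} \<Longrightarrow> \<alpha> + dot (m k) (b k) (\<eta> k) \<le> c k"
    "\<And>k. k \<in> {1..K} \<Longrightarrow> transpose_mult (m k) (A k) (\<eta> k) = \<beta>"
    unfolding polyhedron_E_def by blast
  have "\<alpha> + \<beta> \<bullet> x \<le> c k" if k: "k \<in> {1..K}" and x: "x \<in> P k" for k x
  proof -
    have "x \<in> ineq_polyhedron (m k) (A k) (b k)"
      using cl[OF k] x closure_subset by blast
    then have "\<beta> \<bullet> x \<le> dot (m k) (b k) (\<eta> k)"
      using inner_transpose_mult_le_dot[of x "m k" "A k" "b k" "\<eta> k"] \<eta>(1,3) k by simp
    then show ?thesis using \<eta>(2)[OF k] by linarith
  qed
  then show "(\<alpha>, \<beta>) \<in> ?M" by blast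
next
  fix \<alpha> \<beta> assume M: "(\<alpha>, \<beta>) \<in> ?M"
  have "\<exists>\<eta>. (\<forall>i<m k. 0 \<le> \<eta> i) \<and> \<alpha> + dot (m k) (b k) \<eta> \<le> c k \<and>
      transpose_mult (m k) (A k) \<eta> = \<beta>" if k: "k \<in> {1..K}" for k
  proof -
    have "P k \<subseteq> {x. \<beta> \<bullet> x \<le> c k - \<alpha>}"
      using M k by (auto simp: algebra_simps)
    \<comment> \<open>The bound is known on \<open>P k\<close> only, but a closed halfspace
      containing \<open>P k\<close> contains its closure, which the inequalities describe.\<close>
    then have sub: "closure (P k) \<subseteq> {x. \<beta> \<bullet> x \<le> c k - \<alpha>}"
      by (intro closure_minimal closed_halfspace_le)
    obtain \<eta> where "\<And>i. 0 \<le> \<eta> i" "dot (m k) (b k) \<eta> \<le> c k - \<alpha>"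
      "transpose_mult (m k) (A k) \<eta> = \<beta>"
    proof (rule affine_farkas[of "m k" "A k" "b k" \<beta> "c k - \<alpha>"])
      show "ineq_polyhedron (m k) (A k) (b k) \<noteq> {}"
        using ne[OF k] cl[OF k] by (metis closure_eq_empty)
      show "\<beta> \<bullet> x \<le> c k - \<alpha>" if "x \<in> ineq_polyhedron (m k) (A k) (b k)" for x
        using that sub cl[OF k] by auto
    qed blast
    then show ?thesis by (intro exI[of _ \<eta>]) auto
  qed
  then have "\<exists>\<eta>. \<forall>k\<in>{1..K}. (\<forall>i<m k. 0 \<le> \<eta> k i) \<and> \<alpha> + dot (m k) (b k) (\<eta> k) \<le> c k \<and>
      transpose_mult (m k) (A k) (\<eta> k) = \<beta>"
    by (intro bchoice) blast
  then show "(\<alpha>, \<beta>) \<in> ?E"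
    by (simp add: polyhedron_E_def)
qed

lemma piecewise_constant_eq:
  assumes "\<And>j k. j \<in> {1..K} \<Longrightarrow> k \<in> {1..K} \<Longrightarrow> j \<noteq> k \<Longrightarrow> P j \<inter> P k = {}"
    and "k \<in> {1..K}" "x \<in> P k"
  shows "piecewise_constant K c P x = c k"
proof -
  have "(\<Sum>j=1..K. c j * indicator (P j) x) = (\<Sum>j=1..K. if j = k then c k else 0)"
    using assms by (intro sum.cong refl) (auto simp: indicator_def)
  then show ?thesis
    using assms(2) by (simp add: piecewise_constant_def)
qed

section \<open>Convex envelope and extreme affine minorants\<close>

lemma affine_function_iff_inner:
  fixes a :: "'a::euclidean_space \<Rightarrow> real"
  shows "affine_function a \<longleftrightarrow> (\<exists>\<alpha> \<beta>. a = (\<lambda>x. \<alpha> + \<beta> \<bullet> x))"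
proof
  assume "affine_function a"
  then obtain f c where f: "linear f" "a = (\<lambda>x. c + f x)"
    by (auto simp: affine_function_def)
  \<comment> \<open>\<open>adjoint f 1\<close> is the Riesz representative of the functional
    \<open>f\<close>.\<close>
  have "f x = adjoint f 1 \<bullet> x" for x
    using adjoint_works[OF f(1), of x 1] by (simp add: inner_commute)
  with f show "\<exists>\<alpha> \<beta>. a = (\<lambda>x. \<alpha> + \<beta> \<bullet> x)" by metis
next
  assume "\<exists>\<alpha> \<beta>. a = (\<lambda>x. \<alpha> + \<beta> \<bullet> x)"
  then show "affine_function a"
    unfolding affine_function_def
    by (metis bounded_linear.linear bounded_linear_inner_right)
qed

text \<open>A supremum is at most \<theta> iff all its members are. Without any minorant the
  supremum is minus infinity, and neither side restricts \<theta>.\<close>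

lemma convex_envelope_epigraph_iff:
  fixes X :: "'a::euclidean_space set"
  shows "(x, \<theta>) \<in> convex_envelope_epigraph X g \<longleftrightarrow>
    x \<in> X \<and> (\<forall>(\<alpha>, \<beta>) \<in> {(\<alpha>, \<beta>). \<forall>y\<in>X. \<alpha> + \<beta> \<bullet> y \<le> g y}. \<alpha> + \<beta> \<bullet> x \<le> \<theta>)"
  by (auto simp: convex_envelope_epigraph_def convex_envelope_def SUP_le_iff
      affine_function_iff_inner)

text \<open>The pairing \<open>(\<alpha>, \<beta>) \<mapsto> \<alpha> + \<beta> \<bullet> x\<close> is the inner product with \<open>(1, x)\<close> in the product space.\<close>

lemma affine_minorants_extreme_point_ge:
  fixes X :: "'a::euclidean_space set"
  defines "M g \<equiv> {(\<alpha>, \<beta>). \<forall>y\<in>X. \<alpha> + \<beta> \<bullet> y \<le> g y}"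
  assumes span: "affine hull X = UNIV" and x: "x \<in> X" and M: "(\<alpha>, \<beta>) \<in> M g"
  obtains \<alpha>' \<beta>' where "(\<alpha>', \<beta>') \<in> ext (M g)" "\<alpha> + \<beta> \<bullet> x \<le> \<alpha>' + \<beta>' \<bullet> x"
proof -
  \<comment> \<open>As an intersection of closed halfspaces with normals \<open>(1, y)\<close>, the
    set is closed and convex.\<close>
  have M_eq: "M g = (\<Inter>y\<in>X. {p. (1, y) \<bullet> p \<le> g y})"
    by (auto simp: M_def inner_commute)
  have "\<exists>e. e extreme_point_of M g \<and> (1, x) \<bullet> (\<alpha>, \<beta>) \<le> (1, x) \<bullet> e"
  proof (rule line_free_extreme_point_ge)
    show "closed (M g)" unfolding M_eq by (intro closed_INT ballI closed_halfspace_le)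
    show "convex (M g)" unfolding M_eq by (intro convex_INT convex_halfspace_le)
    show "(1, x) \<bullet> p \<le> g x" if "p \<in> M g" for p
      using that x by (simp add: M_eq)
    show "(\<alpha>, \<beta>) \<in> M g" by fact
    fix p d :: "real \<times> 'a" assume "d \<noteq> 0"
    show "\<exists>t. p + t *\<^sub>R d \<notin> M g"
    proof (rule ccontr)
      assume "\<nexists>t. p + t *\<^sub>R d \<notin> M g"
      then have le: "(1, y) \<bullet> p + t * ((1, y) \<bullet> d) \<le> g y" if "y \<in> X" for y t
        using that by (auto simp: M_eq inner_add_right simp del: inner_Pair)
      have zero: "(1, y) \<bullet> d = 0" if "y \<in> X" for y
      proof (rule ccontr)
        assume "(1, y) \<bullet> d \<noteq> 0"
        \<comment> \<open>The chosen \<open>t\<close> lifts the left-hand side of \<open>le\<close>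
          to \<open>g y + 1\<close>.\<close>
        then show False
          using le[OF that, of "(g y - (1, y) \<bullet> p + 1) / ((1, y) \<bullet> d)"] by simp
      qed
      \<comment> \<open>A line direction \<open>d\<close> confines \<open>X\<close>, and so its
        affine hull, to one level set of \<open>snd d\<close>. As the hull is the whole space,
        testing at \<open>0\<close> and at \<open>snd d\<close> gives \<open>d = 0\<close>.\<close>
      have "X \<subseteq> {y. snd d \<bullet> y = - fst d}"
        using zero by (cases d) (auto simp: inner_commute add_eq_0_iff)
      then have "affine hull X \<subseteq> {y. snd d \<bullet> y = - fst d}"
        by (intro hull_minimal affine_hyperplane)
      then have d: "snd d \<bullet> y = - fst d" for y
        using span by blast
      have "fst d = 0" using d[of 0] by simp
      moreover have "snd d = 0" using d[of "snd d"] \<open>fst d = 0\<close> by simp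
      ultimately show False using \<open>d \<noteq> 0\<close> by (simp add: prod_eq_iff)
    qed
  qed
  then obtain e where "e extreme_point_of M g" "(1, x) \<bullet> (\<alpha>, \<beta>) \<le> (1, x) \<bullet> e" by blast
  then show ?thesis
    using that[of "fst e" "snd e"] by (cases e) (auto simp: ext_def inner_commute)
qed

theorem proposition6:
  fixes I :: "'n::finite set"
    and X :: "(real ^ 'n) set"
    and K :: nat
    and c :: "nat \<Rightarrow> real"
    and P :: "nat \<Rightarrow> (real ^ 'n) set"
    and m :: "nat \<Rightarrow> nat"
    and A :: "nat \<Rightarrow> nat \<Rightarrow> real ^ 'n"
    and b :: "nat \<Rightarrow> nat \<Rightarrow> real"
  assumes "X \<subseteq> mixed_integer_space I"
    and "X \<noteq> {} \<Longrightarrow> affine hull X = UNIV"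
    and "X = (\<Union>k\<in>{1..K}. P k)"
    and "\<And>k. k \<in> {1..K} \<Longrightarrow> P k \<noteq> {}"
    and "\<And>j k. j \<in> {1..K} \<Longrightarrow> k \<in> {1..K} \<Longrightarrow> j \<noteq> k \<Longrightarrow> P j \<inter> P k = {}"
    and "\<And>k. k \<in> {1..K} \<Longrightarrow> closure (P k) = ineq_polyhedron (m k) (A k) (b k)"
  shows "convex_envelope_epigraph X (piecewise_constant K c P) =
    {(x, \<theta>). x \<in> X \<and> (\<forall>(\<alpha>, \<beta>) \<in> ext (polyhedron_E K m A b c). \<theta> \<ge> \<alpha> + \<beta> \<bullet> x)}"
proof -
  define g where "g = piecewise_constant K c P"
  define M where "M = {(\<alpha>, \<beta>). \<forall>y\<in>X. \<alpha> + \<beta> \<bullet> y \<le> g y}"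
  have g: "g x = c k" if "k \<in> {1..K}" "x \<in> P k" for k x
    unfolding g_def using assms(5) that by (rule piecewise_constant_eq)
  have E: "polyhedron_E K m A b c = M"
    using polyhedron_E_eq[OF assms(4,6)] assms(3) g by (fastforce simp: M_def)
  \<comment> \<open>The dominating extreme minorant may depend on \<open>x\<close>, so the two
    conditions are compared pointwise. A point \<open>x \<in> X\<close> also unlocks the spanning
    hypothesis; for empty \<open>X\<close> both sides of the theorem are empty.\<close>
  have "(\<forall>(\<alpha>, \<beta>)\<in>M. \<alpha> + \<beta> \<bullet> x \<le> \<theta>) \<longleftrightarrow> (\<forall>(\<alpha>, \<beta>)\<in>ext M. \<alpha> + \<beta> \<bullet> x \<le> \<theta>)"
    if x: "x \<in> X" for x \<theta>
  proof (intro iffI ballI; clarify)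
    fix \<alpha> \<beta> assume "\<forall>(\<alpha>, \<beta>)\<in>M. \<alpha> + \<beta> \<bullet> x \<le> \<theta>" "(\<alpha>, \<beta>) \<in> ext M"
    then show "\<alpha> + \<beta> \<bullet> x \<le> \<theta>"
      by (auto simp: ext_def extreme_point_of_def)
  next
    fix \<alpha> \<beta> assume *: "\<forall>(\<alpha>, \<beta>)\<in>ext M. \<alpha> + \<beta> \<bullet> x \<le> \<theta>" and "(\<alpha>, \<beta>) \<in> M"
    then obtain \<alpha>' \<beta>' where "(\<alpha>', \<beta>') \<in> ext M" "\<alpha> + \<beta> \<bullet> x \<le> \<alpha>' + \<beta>' \<bullet> x"
      using affine_minorants_extreme_point_ge[of X x \<alpha> \<beta> g] assms(2) x unfolding M_def by blast
    with * show "\<alpha> + \<beta> \<bullet> x \<le> \<theta>" by fastforce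
  qed
  then show ?thesis
    unfolding g_def[symmetric] E
    using convex_envelope_epigraph_iff[of _ _ X g, folded M_def] by (intro set_eqI) (auto 0 4)
qed

end
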